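(* For every integer $k\ge 1$ there is a constant $C(k)$, depending only on $k$, such that for every integer $n\ge 1$ the number of maximal shifted $k$-uniform intersecting set systems over $[n]$ is at most $C(k)$.
   Context: Write $[n]=\{1,2,\dots,n\}$. A $k$-uniform intersecting set system on (or over) $[n]$ is a collection of $k$-element subsets of $[n]$ such that any two sets in the collection have nonempty intersection. A set system $\mathcal{F}$ on $[n]$ is shifted if for all $i<j$ in $[n]$ and all $S\in\mathcal{F}$ with $j\in S$ and $i\notin S$, the set $(S\setminus\{j\})\cup\{i\}$ belongs to $\mathcal{F}$. A maximal shifted $k$-uniform intersecting set system over $[n]$ is a $k$-uniform intersecting set system on $[n]$ that is shifted and that is maximal, i.e. not properly contained in any other $k$-uniform intersecting set system on $[n]$. *)

theory Defs
  imports Main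
begin

definition uniform_intersecting :: "nat \<Rightarrow> nat \<Rightarrow> nat set set \<Rightarrow> bool" where
  "uniform_intersecting k n F \<longleftrightarrow>
     (\<forall>S\<in>F. S \<subseteq> {1..n} \<and> card S = k) \<and> (\<forall>S\<in>F. \<forall>T\<in>F. S \<inter> T \<noteq> {})"

definition shifted :: "nat \<Rightarrow> nat set set \<Rightarrow> bool" where
  "shifted n F \<longleftrightarrow>
     (\<forall>i\<in>{1..n}. \<forall>j\<in>{1..n}. i < j \<longrightarrow>
       (\<forall>S\<in>F. j \<in> S \<and> i \<notin> S \<longrightarrow> (S - {j}) \<union> {i} \<in> F))"

text \<open>Maximality is among all \<open>k\<close>-uniform intersecting set systems on \<open>{1..n}\<close>,
  not only among the shifted ones.\<close>

definition maximal_shifted_intersecting :: "nat \<Rightarrow> nat \<Rightarrow> nat set set \<Rightarrow> bool" where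
  "maximal_shifted_intersecting k n F \<longleftrightarrow>
     uniform_intersecting k n F \<and> shifted n F \<and>
     (\<nexists>G. uniform_intersecting k n G \<and> F \<subset> G)"

text \<open>The set being counted is finite, so \<open>card\<close> is its true cardinality.\<close>

lemma finite_maximal_shifted_intersecting:
  "finite {F. maximal_shifted_intersecting k n F}"
proof (rule finite_subset)
  show "{F. maximal_shifted_intersecting k n F} \<subseteq> Pow (Pow {1..n})"
    by (auto simp: maximal_shifted_intersecting_def uniform_intersecting_def)
  show "finite (Pow (Pow {1..n}))"
    by simp
qed

end

theory Submission
  imports Defs
begin

text \<open>
  In a shifted \<open>k\<close>-uniform intersecting system any two members already meet inside
  \<open>{1..2k-1}\<close> (\<open>shifted_intersecting_meet_low\<close>): if \<open>A\<close> and \<open>B\<close> are disjoint there, they share some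
  \<open>j \<ge> 2k\<close>, so together they occupy at most \<open>2(k-1)\<close> points of \<open>{1..2k-1}\<close>; replacing \<open>j\<close> in \<open>A\<close> by
  a free point of \<open>{1..2k-1}\<close> keeps the two sets disjoint there and makes their intersection smaller,
  and repeating this produces two disjoint members.

  Hence the system of all \<open>k\<close>-subsets of \<open>{1..n}\<close> having the same trace on \<open>{1..2k-1}\<close> as some member
  is again intersecting. A maximal system equals this one, so it is determined by its set of traces,
  which is a set of subsets of \<open>{1..2k-1}\<close>. This gives the bound \<open>C(k) = 2^(2^(2k-1))\<close>.
\<close>

lemma shifted_intersecting_meet_low:
  assumes "k \<ge> 1" and unif: "uniform_intersecting k n F" and shift: "shifted n F"
    and "A \<in> F" "B \<in> F"
  shows "A \<inter> B \<inter> {1..2*k-1} \<noteq> {}"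
  using \<open>A \<in> F\<close>
proof (induction "card (A \<inter> B)" arbitrary: A rule: less_induct)
  case less
  let ?L = "{1..2*k-1}"
  show ?case
  proof
    assume disj: "A \<inter> B \<inter> ?L = {}"
    have A: "A \<subseteq> {1..n}" "card A = k" and B: "B \<subseteq> {1..n}" "card B = k"
      using unif less.prems \<open>B \<in> F\<close> by (auto simp: uniform_intersecting_def)
    have fin: "finite A" "finite B"
      using A(1) B(1) finite_subset by auto
    obtain j where j: "j \<in> A" "j \<in> B"
      using unif less.prems \<open>B \<in> F\<close> unfolding uniform_intersecting_def by blast
    have "j \<notin> ?L"
      using disj j by blast
    have "card (A \<inter> ?L) \<le> card (A - {j})" "card (B \<inter> ?L) \<le> card (B - {j})"
      using fin \<open>j \<notin> ?L\<close> by (auto intro!: card_mono)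
    hence "card (A \<inter> ?L) \<le> k - 1" "card (B \<inter> ?L) \<le> k - 1"
      using A(2) B(2) j fin by auto
    hence "card ((A \<inter> ?L) \<union> (B \<inter> ?L)) < card ?L"
      using card_Un_le[of "A \<inter> ?L" "B \<inter> ?L"] \<open>k \<ge> 1\<close>
      unfolding card_atLeastAtMost by linarith
    hence "(A \<inter> ?L) \<union> (B \<inter> ?L) \<noteq> ?L"
      by auto
    then obtain i where i: "i \<in> ?L" "i \<notin> A" "i \<notin> B"
      by blast
    define A' where "A' = (A - {j}) \<union> {i}"
    have "i < j" "j \<in> {1..n}"
      using i(1) \<open>j \<notin> ?L\<close> A(1) j(1) by auto
    hence "A' \<in> F"
      using shift less.prems i j unfolding shifted_def A'_def by auto
    moreover have "A' \<inter> B = A \<inter> B - {j}"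
      using i(3) by (auto simp: A'_def)
    hence "card (A' \<inter> B) < card (A \<inter> B)"
      using j fin by (simp only:) (rule card_Diff1_less, auto)
    ultimately have "A' \<inter> B \<inter> ?L \<noteq> {}"
      using less.hyps by blast
    thus False
      using disj \<open>A' \<inter> B = A \<inter> B - {j}\<close> by blast
  qed
qed

lemma maximal_shifted_eq_trace_closure:
  assumes "k \<ge> 1" and max: "maximal_shifted_intersecting k n F"
  shows "F = {S. S \<subseteq> {1..n} \<and> card S = k \<and> S \<inter> {1..2*k-1} \<in> (\<lambda>A. A \<inter> {1..2*k-1}) ` F}"
    (is "F = ?G")
proof -
  have unif: "uniform_intersecting k n F" and shift: "shifted n F"
    using max by (auto simp: maximal_shifted_intersecting_def)
  have "F \<subseteq> ?G"
    using unif by (auto simp: uniform_intersecting_def)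
  moreover have "S \<inter> T \<noteq> {}" if ST: "S \<in> ?G" "T \<in> ?G" for S T
  proof -
    obtain A B where "A \<in> F" "B \<in> F"
      and "S \<inter> {1..2*k-1} = A \<inter> {1..2*k-1}" "T \<inter> {1..2*k-1} = B \<inter> {1..2*k-1}"
      using ST by blast
    thus ?thesis
      using shifted_intersecting_meet_low[OF \<open>k \<ge> 1\<close> unif shift] by blast
  qed
  hence "uniform_intersecting k n ?G"
    unfolding uniform_intersecting_def by blast
  ultimately show ?thesis
    using max unfolding maximal_shifted_intersecting_def by blast
qed

lemma card_maximal_shifted_intersecting_le:
  assumes "k \<ge> 1"
  shows "card {F. maximal_shifted_intersecting k n F} \<le> 2 ^ (2 ^ (2*k-1))"
proof -
  let ?M = "{F. maximal_shifted_intersecting k n F}" and ?L = "{1..2*k-1}"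
  let ?trace = "\<lambda>F. (\<lambda>A. A \<inter> ?L) ` F"
  have "inj_on ?trace ?M"
  proof (rule inj_onI)
    fix F G assume "F \<in> ?M" "G \<in> ?M" and eq: "?trace F = ?trace G"
    hence F: "maximal_shifted_intersecting k n F" and G: "maximal_shifted_intersecting k n G"
      by simp_all
    have "F = {S. S \<subseteq> {1..n} \<and> card S = k \<and> S \<inter> ?L \<in> ?trace F}"
      by (rule maximal_shifted_eq_trace_closure[OF assms F])
    also have "\<dots> = {S. S \<subseteq> {1..n} \<and> card S = k \<and> S \<inter> ?L \<in> ?trace G}"
      by (simp only: eq)
    also have "\<dots> = G"
      by (rule maximal_shifted_eq_trace_closure[OF assms G, symmetric])
    finally show "F = G" .
  qed
  moreover have "?trace ` ?M \<subseteq> Pow (Pow ?L)"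
    by auto
  ultimately have "card ?M \<le> card (Pow (Pow ?L))"
    by (rule card_inj_on_le) simp
  thus ?thesis
    by (simp add: card_Pow)
qed

theorem mainTheorem1:
  "\<forall>k::nat. k \<ge> 1 \<longrightarrow>
     (\<exists>C::nat. \<forall>n::nat. n \<ge> 1 \<longrightarrow>
        card {F. maximal_shifted_intersecting k n F} \<le> C)"
  using card_maximal_shifted_intersecting_le by blast

end
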